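(* Suppose $V$ is a simple smooth $F(\frac12)$-module such that $z$ acts on $V$ as a scalar $\lambda\in\mathbb{C}^*$. Then $V\cong\mathscr{V}(\frac12)^{\sqrt\lambda}$ for some $\sqrt\lambda\in\mathbb{C}$ with $(\sqrt\lambda)^2=\lambda$.
   Context: All vector spaces and algebras are over $\mathbb{C}$; $\mathbb{Z}_+$ is the set of non-negative integers, $\mathbb{C}^*$ the set of nonzero complex numbers. Modules over Lie superalgebras are $\mathbb{Z}_2$-graded, and simple means having no nonzero proper graded submodule. The Fermion algebra $F(\frac12)$ is the Lie superalgebra with basis $\{\psi_m, z: m\in\mathbb{Z}+\frac12\}$, the $\psi_m$ odd and $z$ even, with $[\psi_m,\psi_n]=\delta_{m,-n}z$ and $[F(\frac12),z]=0$. An $F(\frac12)$-module $V$ is smooth if for every $v\in V$ there is $n\in\mathbb{Z}_+$ with $\psi_iv=0$ for all $i>n$. $\mathscr{V}(\frac12)$ is the exterior algebra generated by odd elements $\xi_i$, $i\in\mathbb{Z}_++\frac12$, with the $F(\frac12)$-module structure in which, for $n\in\mathbb{Z}_++\frac12$, $\psi_n$ acts as the odd derivation $\partial/\partial\xi_n$, $\psi_{-n}$ acts as left multiplication by $\xi_n$, and $z$ acts as the identity. For $\mu\in\mathbb{C}^*$, let $\sigma_\mu$ be the automorphism of $F(\frac12)$ with $\sigma_\mu(\psi_l)=\mu\psi_l$ for $l\in\mathbb{Z}+\frac12$ and $\sigma_\mu(z)=\mu^2z$. For an $F(\frac12)$-module $V$, $V^\mu$ denotes the module with the same underlying space and action $x\cdot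 v=\sigma_\mu(x)v$. *)

theory Defs
  imports Complex_Main "HOL-Library.Z2" "HOL-Library.FSet" "HOL-Library.Poly_Mapping"
begin

section \<open>Super vector spaces, Lie superalgebras and their modules over the complex numbers\<close>

text \<open>Parities are elements of the two-element field \<^typ>\<open>bit\<close>; \<open>gr 0\<close> is the even part and
  \<open>gr 1\<close> the odd part.\<close>

locale super_vector_space = vector_space scale
  for scale :: "complex \<Rightarrow> 'a::ab_group_add \<Rightarrow> 'a" +
  fixes gr :: "bit \<Rightarrow> 'a set"
  assumes gr_subspace: "subspace (gr i)"
    and gr_decomp: "\<exists>a\<in>gr 0. \<exists>b\<in>gr 1. v = a + b"
    and gr_disjoint: "gr 0 \<inter> gr 1 = {0}"

definition koszul :: "bit \<Rightarrow> bit \<Rightarrow> complex" where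
  "koszul i j = (if i = 1 \<and> j = 1 then -1 else 1)"

locale lie_superalgebra = super_vector_space scale gr
  for scale :: "complex \<Rightarrow> 'l::ab_group_add \<Rightarrow> 'l" and gr :: "bit \<Rightarrow> 'l set" +
  fixes br :: "'l \<Rightarrow> 'l \<Rightarrow> 'l"
  assumes br_linear_left: "Vector_Spaces.linear scale scale (\<lambda>x. br x y)"
    and br_linear_right: "Vector_Spaces.linear scale scale (br x)"
    and br_graded: "x \<in> gr i \<Longrightarrow> y \<in> gr j \<Longrightarrow> br x y \<in> gr (i + j)"
    and br_skew: "x \<in> gr i \<Longrightarrow> y \<in> gr j \<Longrightarrow> br x y = - scale (koszul i j) (br y x)"
    and br_jacobi: "x \<in> gr i \<Longrightarrow> y \<in> gr j \<Longrightarrow>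
      br x (br y w) = br (br x y) w + scale (koszul i j) (br y (br x w))"

locale lie_supermodule =
  L: lie_superalgebra lscale lgr br + M: super_vector_space scale gr
  for lscale :: "complex \<Rightarrow> 'l::ab_group_add \<Rightarrow> 'l" and lgr :: "bit \<Rightarrow> 'l set"
    and br :: "'l \<Rightarrow> 'l \<Rightarrow> 'l"
    and scale :: "complex \<Rightarrow> 'v::ab_group_add \<Rightarrow> 'v" and gr :: "bit \<Rightarrow> 'v set" +
  fixes act :: "'l \<Rightarrow> 'v \<Rightarrow> 'v"
  assumes act_linear_left: "Vector_Spaces.linear lscale scale (\<lambda>x. act x v)"
    and act_linear_right: "Vector_Spaces.linear scale scale (act x)"
    and act_graded: "x \<in> lgr i \<Longrightarrow> v \<in> gr j \<Longrightarrow> act x v \<in> gr (i + j)"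
    and act_bracket: "x \<in> lgr i \<Longrightarrow> y \<in> lgr j \<Longrightarrow>
      act (br x y) v = act x (act y v) - scale (koszul i j) (act y (act x v))"

definition graded_submodule ::
  "(complex \<Rightarrow> 'v::ab_group_add \<Rightarrow> 'v) \<Rightarrow> (bit \<Rightarrow> 'v set) \<Rightarrow> ('l \<Rightarrow> 'v \<Rightarrow> 'v) \<Rightarrow> 'v set \<Rightarrow> bool" where
  "graded_submodule scale gr act W \<longleftrightarrow>
     module.subspace scale W \<and>
     (\<forall>w\<in>W. \<exists>a\<in>W \<inter> gr 0. \<exists>b\<in>W \<inter> gr 1. w = a + b) \<and>
     (\<forall>x. \<forall>w\<in>W. act x w \<in> W)"

definition simple_supermodule ::
  "(complex \<Rightarrow> 'v::ab_group_add \<Rightarrow> 'v) \<Rightarrow> (bit \<Rightarrow> 'v set) \<Rightarrow> ('l \<Rightarrow> 'v \<Rightarrow> 'v) \<Rightarrow> bool" where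
  "simple_supermodule scale gr act \<longleftrightarrow>
     (UNIV :: 'v set) \<noteq> {0} \<and>
     (\<forall>W. graded_submodule scale gr act W \<longrightarrow> W = {0} \<or> W = UNIV)"

text \<open>Isomorphisms are homogeneous of some parity \<open>p\<close>, so a module is identified with its parity
  shift. (Even maps alone would separate a Fock module from its shift: the vacuum line is canonical.)
  For an odd map the alternative convention \<open>f (x v) = (-1)\<^bsup>|x|\<^esup> x (f v)\<close> yields the same relation:
  compose \<open>f\<close> with the parity automorphism of the target.\<close>

definition supermodule_isomorphic ::
  "(complex \<Rightarrow> 'v::ab_group_add \<Rightarrow> 'v) \<Rightarrow> (bit \<Rightarrow> 'v set) \<Rightarrow> ('l \<Rightarrow> 'v \<Rightarrow> 'v) \<Rightarrow>
   (complex \<Rightarrow> 'w::ab_group_add \<Rightarrow> 'w) \<Rightarrow> (bit \<Rightarrow> 'w set) \<Rightarrow> ('l \<Rightarrow> 'w \<Rightarrow> 'w) \<Rightarrow> bool" where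
  "supermodule_isomorphic s1 gr1 act1 s2 gr2 act2 \<longleftrightarrow>
     (\<exists>f p. Vector_Spaces.linear s1 s2 f \<and> bij f \<and>
            (\<forall>i. f ` gr1 i = gr2 (i + p)) \<and>
            (\<forall>x v. f (act1 x v) = act2 x (f v)))"


section \<open>Free vector spaces\<close>

text \<open>The complex vector space with basis \<^typ>\<open>'a\<close> is \<^typ>\<open>'a \<Rightarrow>\<^sub>0 complex\<close>.\<close>

definition fscale :: "complex \<Rightarrow> ('a \<Rightarrow>\<^sub>0 complex) \<Rightarrow> ('a \<Rightarrow>\<^sub>0 complex)" where
  "fscale c = Poly_Mapping.map ((*) c)"

definition basis :: "'a \<Rightarrow> ('a \<Rightarrow>\<^sub>0 complex)" where
  "basis a = Poly_Mapping.single a 1"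

definition lin_ext :: "('a \<Rightarrow> ('b \<Rightarrow>\<^sub>0 complex)) \<Rightarrow> ('a \<Rightarrow>\<^sub>0 complex) \<Rightarrow> ('b \<Rightarrow>\<^sub>0 complex)" where
  "lin_ext f v = (\<Sum>a\<in>Poly_Mapping.keys v. fscale (Poly_Mapping.lookup v a) (f a))"

definition bilin_ext ::
  "('a \<Rightarrow> 'b \<Rightarrow> ('c \<Rightarrow>\<^sub>0 complex)) \<Rightarrow> ('a \<Rightarrow>\<^sub>0 complex) \<Rightarrow> ('b \<Rightarrow>\<^sub>0 complex) \<Rightarrow> ('c \<Rightarrow>\<^sub>0 complex)" where
  "bilin_ext f v w = lin_ext (\<lambda>a. lin_ext (f a) w) v"


section \<open>The Fermion algebra\<close>

text \<open>The half-integer \<open>k + 1/2\<close> is represented by the integer \<open>k\<close>, so \<open>Psi k\<close> stands for the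
  basis vector with index \<open>k + 1/2\<close>; negating the half-integer sends \<open>k\<close> to \<open>- k - 1\<close>.\<close>

definition half :: "int \<Rightarrow> rat" where
  "half k = of_int k + 1 / 2"

datatype fermion_basis = Psi int | Zc

type_synonym fermion = "fermion_basis \<Rightarrow>\<^sub>0 complex"

abbreviation psi :: "int \<Rightarrow> fermion" where "psi k \<equiv> basis (Psi k)"
abbreviation zc :: fermion where "zc \<equiv> basis Zc"

definition fermion_gr :: "bit \<Rightarrow> fermion set" where
  "fermion_gr i = (if i = 0 then {x. \<forall>k. Poly_Mapping.lookup x (Psi k) = 0}
                   else {x. Poly_Mapping.lookup x Zc = 0})"

fun fermion_br_basis :: "fermion_basis \<Rightarrow> fermion_basis \<Rightarrow> fermion" where
  "fermion_br_basis (Psi m) (Psi n) = (if half m = - half n then zc else 0)"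
| "fermion_br_basis Zc _ = 0"
| "fermion_br_basis _ Zc = 0"

definition fermion_br :: "fermion \<Rightarrow> fermion \<Rightarrow> fermion" where
  "fermion_br = bilin_ext fermion_br_basis"

abbreviation fermion_module ::
  "(complex \<Rightarrow> 'v::ab_group_add \<Rightarrow> 'v) \<Rightarrow> (bit \<Rightarrow> 'v set) \<Rightarrow> (fermion \<Rightarrow> 'v \<Rightarrow> 'v) \<Rightarrow> bool" where
  "fermion_module \<equiv> lie_supermodule fscale fermion_gr fermion_br"

definition smooth :: "(fermion \<Rightarrow> 'v::zero \<Rightarrow> 'v) \<Rightarrow> bool" where
  "smooth act \<longleftrightarrow> (\<forall>v. \<exists>n::nat. \<forall>i. half i > of_nat n \<longrightarrow> act (psi i) v = 0)"

fun sigma_basis :: "complex \<Rightarrow> fermion_basis \<Rightarrow> fermion" where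
  "sigma_basis \<mu> (Psi k) = fscale \<mu> (psi k)"
| "sigma_basis \<mu> Zc = fscale (\<mu>^2) zc"

definition sigma :: "complex \<Rightarrow> fermion \<Rightarrow> fermion" where
  "sigma \<mu> = lin_ext (sigma_basis \<mu>)"

definition twist :: "complex \<Rightarrow> (fermion \<Rightarrow> 'v \<Rightarrow> 'v) \<Rightarrow> (fermion \<Rightarrow> 'v \<Rightarrow> 'v)" where
  "twist \<mu> act x v = act (sigma \<mu> x) v"


section \<open>The exterior algebra and the Fock module\<close>

text \<open>The natural number \<open>n\<close> represents the index \<open>n + 1/2\<close>. The finite set
  \<open>S = {n\<^sub>1 < \<dots> < n\<^sub>r}\<close> represents the monomial \<open>\<xi>\<^bsub>n\<^sub>1\<^esub> \<dots> \<xi>\<^bsub>n\<^sub>r\<^esub>\<close>, and these monomials are a basis of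
  the exterior algebra. The sign of a product of monomials counts the inversions removed by
  sorting the concatenated list of generators.\<close>

type_synonym ext = "nat fset \<Rightarrow>\<^sub>0 complex"

definition inversions :: "nat fset \<Rightarrow> nat fset \<Rightarrow> nat" where
  "inversions S T = card {(s, t). s |\<in>| S \<and> t |\<in>| T \<and> t < s}"

definition wedge_basis :: "nat fset \<Rightarrow> nat fset \<Rightarrow> ext" where
  "wedge_basis S T =
     (if S |\<inter>| T = {||} then fscale ((-1) ^ inversions S T) (basis (S |\<union>| T)) else 0)"

definition wedge :: "ext \<Rightarrow> ext \<Rightarrow> ext" (infixl \<open>\<odot>\<close> 70) where
  "wedge = bilin_ext wedge_basis"

definition ext_one :: ext where "ext_one = basis {||}"

definition xi :: "nat \<Rightarrow> ext" where "xi n = basis {|n|}"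

definition ext_gr :: "bit \<Rightarrow> ext set" where
  "ext_gr i = {v. \<forall>S\<in>Poly_Mapping.keys v. of_nat (fcard S) = i}"

text \<open>The odd derivation with \<open>\<partial>\<^sub>n \<xi>\<^sub>m = \<delta>\<^sub>m\<^sub>n\<close>; on a monomial it moves \<open>\<xi>\<^sub>n\<close> to the front and
  removes it. See \<open>pd_derivation\<close>, \<open>pd_xi\<close> and \<open>pd_unique\<close> below.\<close>

definition pd_basis :: "nat \<Rightarrow> nat fset \<Rightarrow> ext" where
  "pd_basis n S =
     (if n |\<in>| S then fscale ((-1) ^ card {s. s |\<in>| S \<and> s < n}) (basis (S |-| {|n|})) else 0)"

definition pd :: "nat \<Rightarrow> ext \<Rightarrow> ext" where
  "pd n = lin_ext (pd_basis n)"

text \<open>For \<open>k < 0\<close> the vector \<open>Psi k\<close> has index \<open>-(n + 1/2)\<close> with \<open>n = - k - 1\<close>.\<close>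

fun fock_basis :: "fermion_basis \<Rightarrow> ext \<Rightarrow> ext" where
  "fock_basis (Psi k) v = (if k \<ge> 0 then pd (nat k) v else xi (nat (- k - 1)) \<odot> v)"
| "fock_basis Zc v = v"

definition fock_act :: "fermion \<Rightarrow> ext \<Rightarrow> ext" where
  "fock_act x v = lin_ext (\<lambda>b. fock_basis b v) x"


section \<open>Basic facts on linear extension\<close>

lemma lookup_fscale [simp]: "Poly_Mapping.lookup (fscale c v) a = c * Poly_Mapping.lookup v a"
  by (simp add: fscale_def Poly_Mapping.map.rep_eq when_def)

lemma lookup_basis: "Poly_Mapping.lookup (basis a) b = (if a = b then 1 else 0)"
  by (simp add: basis_def lookup_single when_def)

lemma fscale_simps [simp]:
  "fscale c (0::'a \<Rightarrow>\<^sub>0 complex) = 0" "fscale 0 v = 0" "fscale 1 v = v"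
  "fscale c (fscale d v) = fscale (c * d) v"
  by (auto intro!: poly_mapping_eqI)

lemma fscale_distribs:
  "fscale c (v + w) = fscale c v + fscale c w" "fscale (c + d) v = fscale c v + fscale d v"
  "fscale c (v - w) = fscale c v - fscale c w" "fscale c (- v) = - fscale c v"
  "fscale (- c) v = - fscale c v"
  by (auto intro!: poly_mapping_eqI simp: lookup_add lookup_minus algebra_simps)

interpretation free: vector_space "fscale :: complex \<Rightarrow> ('a \<Rightarrow>\<^sub>0 complex) \<Rightarrow> _"
  by unfold_locales (auto simp: fscale_distribs)

abbreviation flinear :: "(('a \<Rightarrow>\<^sub>0 complex) \<Rightarrow> ('b \<Rightarrow>\<^sub>0 complex)) \<Rightarrow> bool" where
  "flinear \<equiv> Vector_Spaces.linear fscale fscale"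

lemma flinear_iff:
  "flinear f \<longleftrightarrow> (\<forall>v w. f (v + w) = f v + f w) \<and> (\<forall>c v. f (fscale c v) = fscale c (f v))"
  unfolding module_hom_iff_linear[symmetric] module_hom_iff
  by (simp add: free.module_axioms)

lemma lookup_lin_ext:
  assumes "finite A" "Poly_Mapping.keys v \<subseteq> A"
  shows "Poly_Mapping.lookup (lin_ext f v) b =
           (\<Sum>a\<in>A. Poly_Mapping.lookup v a * Poly_Mapping.lookup (f a) b)"
  unfolding lin_ext_def lookup_sum lookup_fscale
  by (rule sum.mono_neutral_left) (use assms in \<open>auto simp: in_keys_iff\<close>)

lemma flinear_lin_ext [simp, intro]: "flinear (lin_ext f)"
proof -
  have add: "lin_ext f (v + w) = lin_ext f v + lin_ext f w" for v w
  proof (rule poly_mapping_eqI)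
    fix b
    let ?A = "Poly_Mapping.keys v \<union> Poly_Mapping.keys w \<union> Poly_Mapping.keys (v + w)"
    have "finite ?A" by simp
    then show "Poly_Mapping.lookup (lin_ext f (v + w)) b =
        Poly_Mapping.lookup (lin_ext f v + lin_ext f w) b"
      by (simp add: lookup_lin_ext[of ?A] le_supI1 le_supI2 lookup_add sum.distrib[symmetric]
          algebra_simps)
  qed
  have scale: "lin_ext f (fscale c v) = fscale c (lin_ext f v)" for c v
  proof (rule poly_mapping_eqI)
    fix b
    let ?A = "Poly_Mapping.keys v \<union> Poly_Mapping.keys (fscale c v)"
    have "finite ?A" by simp
    then show "Poly_Mapping.lookup (lin_ext f (fscale c v)) b =
        Poly_Mapping.lookup (fscale c (lin_ext f v)) b"
      by (simp add: lookup_lin_ext[of ?A] sum_distrib_left algebra_simps)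
  qed
  show ?thesis by (simp add: flinear_iff add scale)
qed

lemmas lin_ext_simps [simp] =
  flinear_lin_ext[unfolded flinear_iff, THEN conjunct1, rule_format]
  flinear_lin_ext[unfolded flinear_iff, THEN conjunct2, rule_format]

lemma lin_ext_basis [simp]: "lin_ext f (basis a) = f a"
  by (simp add: lin_ext_def basis_def)

lemma basis_expansion: "v = lin_ext basis v"
  by (rule poly_mapping_eqI)
    (auto simp: lookup_lin_ext[of "Poly_Mapping.keys v"] lookup_basis in_keys_iff
      if_distrib[of "(*) _"] cong: if_cong)

lemma flinear_0: "flinear f \<Longrightarrow> f 0 = 0"
  by (metis flinear_iff fscale_simps(2))

lemma flinear_expand:
  assumes "flinear f"
  shows "f v = lin_ext (\<lambda>a. f (basis a)) v"
proof -
  have "f (\<Sum>a\<in>A. fscale (c a) (basis a)) = (\<Sum>a\<in>A. fscale (c a) (f (basis a)))"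
    if "finite A" for A and c :: "'a \<Rightarrow> complex"
    using that assms by (induction A rule: finite_induct) (auto simp: flinear_0 flinear_iff)
  then have "f (lin_ext basis v) = lin_ext (\<lambda>a. f (basis a)) v"
    by (simp add: lin_ext_def)
  then show ?thesis by (simp flip: basis_expansion)
qed

lemma lin_ext_cong:
  "(\<And>a. a \<in> Poly_Mapping.keys v \<Longrightarrow> f a = g a) \<Longrightarrow> lin_ext f v = lin_ext g v"
  by (simp add: lin_ext_def)

lemma flinear_eq_on_keys:
  assumes "flinear f" "flinear g" "\<And>a. a \<in> Poly_Mapping.keys v \<Longrightarrow> f (basis a) = g (basis a)"
  shows "f v = g v"
  using assms flinear_expand[of f v] flinear_expand[of g v] by (metis lin_ext_cong)

lemma flinear_eqI:
  assumes "flinear f" "flinear g" "\<And>a. f (basis a) = g (basis a)"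
  shows "f v = g v"
  using assms by (rule flinear_eq_on_keys)

lemma flinear_id: "flinear (\<lambda>v. v)" and flinear_zero: "flinear (\<lambda>v. 0)"
  by (auto simp: flinear_iff)

lemma flinear_compose: "flinear f \<Longrightarrow> flinear g \<Longrightarrow> flinear (\<lambda>v. f (g v))"
  by (auto simp: flinear_iff)

lemma flinear_fscale: "flinear f \<Longrightarrow> flinear (\<lambda>v. fscale c (f v))"
  by (auto simp: flinear_iff fscale_distribs mult.commute)

lemma flinear_add: "flinear f \<Longrightarrow> flinear g \<Longrightarrow> flinear (\<lambda>v. f v + g v)"
  and flinear_diff: "flinear f \<Longrightarrow> flinear g \<Longrightarrow> flinear (\<lambda>v. f v - g v)"
  by (auto simp: flinear_iff fscale_distribs algebra_simps)

lemma lin_ext_add_fun: "lin_ext (\<lambda>a. f a + g a) v = lin_ext f v + lin_ext g v"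
  by (simp add: lin_ext_def fscale_distribs sum.distrib)

lemma lin_ext_fscale_fun: "lin_ext (\<lambda>a. fscale c (f a)) v = fscale c (lin_ext f v)"
  by (simp add: lin_ext_def free.scale_sum_right mult.commute)

lemma lin_ext_zero_fun: "lin_ext (\<lambda>a. 0) v = 0"
  by (simp add: lin_ext_def)

lemma flinear_lin_ext_fun:
  assumes "\<And>a. flinear (f a)"
  shows "flinear (\<lambda>w. lin_ext (\<lambda>a. f a w) v)"
  using assms by (auto simp: flinear_iff lin_ext_add_fun lin_ext_fscale_fun)

lemma flinear_bilin_ext: "flinear (bilin_ext f v)" "flinear (\<lambda>v. bilin_ext f v w)"
  unfolding bilin_ext_def by (auto intro: flinear_lin_ext_fun)

lemma bilin_ext_basis [simp]: "bilin_ext f (basis a) (basis b) = f a b"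
  by (simp add: bilin_ext_def)


section \<open>The exterior algebra and the derivations \<open>\<partial>\<^sub>n\<close>\<close>

lemma flinear_wedge: "flinear (wedge v)" "flinear (\<lambda>v. v \<odot> w)"
  unfolding wedge_def by (rule flinear_bilin_ext)+

lemma flinear_pd: "flinear (pd n)"
  by (simp add: pd_def)

lemma wedge_linear [simp]:
  "(u + v) \<odot> w = u \<odot> w + v \<odot> w" "w \<odot> (u + v) = w \<odot> u + w \<odot> v"
  "fscale c u \<odot> w = fscale c (u \<odot> w)" "w \<odot> fscale c u = fscale c (w \<odot> u)"
  "0 \<odot> w = 0" "w \<odot> 0 = 0"
  using flinear_wedge[unfolded flinear_iff] flinear_wedge[THEN flinear_0] by auto

lemma pd_linear [simp]:
  "pd n (u + v) = pd n u + pd n v" "pd n (fscale c u) = fscale c (pd n u)" "pd n 0 = 0"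
  using flinear_pd[unfolded flinear_iff] flinear_pd[THEN flinear_0] by auto

lemma wedge_basis_basis [simp]: "basis S \<odot> basis T = wedge_basis S T"
  by (simp add: wedge_def)

lemma pd_basis_basis [simp]: "pd n (basis S) = pd_basis n S"
  by (simp add: pd_def)

lemma finite_inversions [simp]: "finite {(s, t). s |\<in>| S \<and> t |\<in>| T \<and> t < (s::nat)}"
  by (rule finite_subset[of _ "fset S \<times> fset T"]) auto

lemma inversions_union_left:
  assumes "S |\<inter>| T = {||}"
  shows "inversions (S |\<union>| T) U = inversions S U + inversions T U"
proof -
  have "{(s, t). s |\<in>| S |\<union>| T \<and> t |\<in>| U \<and> t < s} =
      {(s, t). s |\<in>| S \<and> t |\<in>| U \<and> t < s} \<union> {(s, t). s |\<in>| T \<and> t |\<in>| U \<and> t < s}" by auto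
  then show ?thesis unfolding inversions_def
    by (simp only:) (rule card_Un_disjoint, use assms in auto)
qed

lemma inversions_union_right:
  assumes "S |\<inter>| T = {||}"
  shows "inversions U (S |\<union>| T) = inversions U S + inversions U T"
proof -
  have "{(s, t). s |\<in>| U \<and> t |\<in>| S |\<union>| T \<and> t < s} =
      {(s, t). s |\<in>| U \<and> t |\<in>| S \<and> t < s} \<union> {(s, t). s |\<in>| U \<and> t |\<in>| T \<and> t < s}" by auto
  then show ?thesis unfolding inversions_def
    by (simp only:) (rule card_Un_disjoint, use assms in auto)
qed

lemma inversions_empty [simp]: "inversions {||} T = 0" "inversions S {||} = 0"
  by (simp_all add: inversions_def)

lemma inversions_swap:
  assumes "S |\<inter>| T = {||}"
  shows "inversions S T + inversions T S = fcard S * fcard T"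
proof -
  let ?A = "{(s, t). s |\<in>| S \<and> t |\<in>| T \<and> t < s}" and ?B = "{(s, t). s |\<in>| T \<and> t |\<in>| S \<and> t < s}"
  have swap: "prod.swap ` ?B = {(s, t). s |\<in>| S \<and> t |\<in>| T \<and> s < t}"
    by auto
  have "s \<noteq> t" if "s |\<in>| S" "t |\<in>| T" for s t
    using assms that by blast
  then have "fset S \<times> fset T = ?A \<union> prod.swap ` ?B"
    unfolding swap using linorder_neq_iff by blast
  moreover have "card (?A \<union> prod.swap ` ?B) = card ?A + card (prod.swap ` ?B)"
    by (rule card_Un_disjoint) auto
  moreover have "card (prod.swap ` ?B) = card ?B"
    by (rule card_image) simp
  moreover have "card (fset S \<times> fset T) = fcard S * fcard T"
    by (simp add: card_cartesian_product fcard.rep_eq)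
  ultimately show ?thesis unfolding inversions_def by argo
qed

lemma wedge_assoc_basis: "(basis S \<odot> basis T) \<odot> basis U = basis S \<odot> (basis T \<odot> basis U)"
proof (cases "S |\<inter>| T = {||} \<and> S |\<inter>| U = {||} \<and> T |\<inter>| U = {||}")
  case True
  then have "(S |\<union>| T) |\<inter>| U = {||}" "S |\<inter>| (T |\<union>| U) = {||}" by (simp_all add: inf_sup_distrib1 inf_sup_distrib2)
  with True show ?thesis
    by (simp add: wedge_basis_def inversions_union_left inversions_union_right power_add
        funion_assoc mult_ac)
next
  case False
  have "(S |\<union>| T) |\<inter>| U = {||} \<longleftrightarrow> S |\<inter>| U = {||} \<and> T |\<inter>| U = {||}"
    "S |\<inter>| (T |\<union>| U) = {||} \<longleftrightarrow> S |\<inter>| T = {||} \<and> S |\<inter>| U = {||}"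
    by (simp_all add: inf_sup_distrib1 inf_sup_distrib2)
  with False show ?thesis by (simp add: wedge_basis_def)
qed

lemma wedge_assoc: "(u \<odot> v) \<odot> w = u \<odot> (v \<odot> w)"
proof -
  note [simp del] = wedge_basis_basis
  have 1: "(basis S \<odot> basis T) \<odot> w = basis S \<odot> (basis T \<odot> w)" for S T
    by (rule flinear_eqI[where v = w]) (simp_all add: flinear_iff wedge_assoc_basis)
  have 2: "(basis S \<odot> v) \<odot> w = basis S \<odot> (v \<odot> w)" for S
    by (rule flinear_eqI[where v = v]) (simp_all add: flinear_iff 1)
  show ?thesis
    by (rule flinear_eqI[where v = u]) (simp_all add: flinear_iff 2)
qed

lemma ext_one_wedge: "ext_one \<odot> v = v" "v \<odot> ext_one = v"
proof -
  show "ext_one \<odot> v = v"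
    by (rule flinear_eqI[where v = v]) (simp_all add: flinear_iff ext_one_def wedge_basis_def)
  show "v \<odot> ext_one = v"
    by (rule flinear_eqI[where v = v]) (simp_all add: flinear_iff ext_one_def wedge_basis_def)
qed

lemma xi_anticommute: "xi m \<odot> xi n = - (xi n \<odot> xi m)"
proof (cases "m = n")
  case True
  then show ?thesis by (simp add: xi_def wedge_basis_def)
next
  case False
  then have "inversions {|m|} {|n|} + inversions {|n|} {|m|} = 1"
    using inversions_swap[of "{|m|}" "{|n|}"] by (simp add: fcard.rep_eq)
  then have "inversions {|m|} {|n|} = 0 \<and> inversions {|n|} {|m|} = 1 \<or>
      inversions {|m|} {|n|} = 1 \<and> inversions {|n|} {|m|} = 0" by linarith
  moreover have "{|m|} |\<union>| {|n|} = {|n|} |\<union>| {|m|}" by auto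
  ultimately show ?thesis using False
    by (auto simp: xi_def wedge_basis_def fscale_distribs)
qed

lemma pd_xi: "pd n (xi m) = (if m = n then ext_one else 0)"
proof -
  have "{s. s = n \<and> s < n} = {}" by auto
  then have "card {s. s = n \<and> s < n} = 0" by (simp only: card.empty)
  then show ?thesis by (auto simp: xi_def pd_basis_def ext_one_def simp del: card_0_eq)
qed


lemma basis_wedge_xi: "basis S \<odot> xi n = fscale ((-1) ^ fcard S) (xi n \<odot> basis S)"
proof (cases "n |\<in>| S")
  case True
  then show ?thesis by (auto simp: xi_def wedge_basis_def)
next
  case False
  then have inv: "inversions S {|n|} + inversions {|n|} S = fcard S"
    using inversions_swap[of S "{|n|}"] by (auto simp: fcard.rep_eq)
  have "(-1) ^ fcard S * (-1) ^ inversions {|n|} S = ((-1) ^ inversions S {|n|} :: complex)"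
    by (simp add: power_add mult.assoc flip: inv)
  with False show ?thesis by (auto simp: xi_def wedge_basis_def)
qed

lemma basis_finsert:
  assumes "n |\<notin>| S"
  shows "\<exists>c. basis (finsert n S) = fscale c (xi n \<odot> basis S)"
  using assms
  by (intro exI[of _ "(-1) ^ inversions {|n|} S"])
    (auto simp: xi_def wedge_basis_def simp flip: power_add)

lemma basis_split:
  assumes "n |\<in>| S"
  obtains c T where "n |\<notin>| T" "fcard S = Suc (fcard T)" "basis S = fscale c (xi n \<odot> basis T)"
proof -
  have "S = finsert n (S |-| {|n|})" using assms by auto
  moreover have "n |\<notin>| S |-| {|n|}" by simp
  ultimately show thesis using that basis_finsert[of n "S |-| {|n|}"]
    by (metis fcard_finsert_disjoint)
qed

lemma pd_basis_notin: "n |\<notin>| S \<Longrightarrow> pd n (basis S) = 0"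
  by (simp add: pd_basis_def)

lemma pd_xi_wedge_basis: "n |\<notin>| S \<Longrightarrow> pd n (xi n \<odot> basis S) = basis S"
proof -
  assume n: "n |\<notin>| S"
  have "{(s, t). s = n \<and> t |\<in>| S \<and> t < s} = Pair n ` {s. s |\<in>| S \<and> s < n}" by auto
  then have "inversions {|n|} S = card {s. s |\<in>| S \<and> s < n}"
    by (simp add: inversions_def card_image inj_on_def)
  moreover have "{s. (s = n \<or> s |\<in>| S) \<and> s < n} = {s. s |\<in>| S \<and> s < n}" by auto
  moreover have "finsert n S |-| {|n|} = S" using n by auto
  ultimately show ?thesis using n
    by (simp add: xi_def wedge_basis_def pd_basis_def flip: power_add mult_2)
qed

lemma pd_wedge_free:
  assumes "n |\<notin>| S" "n |\<notin>| T"
  shows "pd n (basis S \<odot> basis T) = 0"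
    and "pd n (xi n \<odot> (basis S \<odot> basis T)) = basis S \<odot> basis T"
  using assms pd_xi_wedge_basis[of n "S |\<union>| T"] pd_basis_notin[of n "S |\<union>| T"]
  by (auto simp: wedge_basis_def)

lemma xi_xi [simp]: "xi n \<odot> xi n = 0" "xi n \<odot> (xi n \<odot> v) = 0"
proof -
  show *: "xi n \<odot> xi n = 0" by (simp add: xi_def wedge_basis_def)
  show "xi n \<odot> (xi n \<odot> v) = 0" by (simp add: * flip: wedge_assoc)
qed

lemma basis_wedge_xi_wedge:
  "basis S \<odot> (xi n \<odot> v) = fscale ((-1) ^ fcard S) (xi n \<odot> (basis S \<odot> v))"
  by (metis basis_wedge_xi wedge_assoc wedge_linear(3))

lemma pd_derivation_basis:
  "pd n (basis S \<odot> basis T) =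
     pd n (basis S) \<odot> basis T + fscale ((-1) ^ fcard S) (basis S \<odot> pd n (basis T))"
proof -
  note [simp del] = wedge_basis_basis pd_basis_basis
  consider "n |\<notin>| S" "n |\<notin>| T" | "n |\<in>| S" "n |\<notin>| T" | "n |\<notin>| S" "n |\<in>| T" | "n |\<in>| S" "n |\<in>| T"
    by blast
  then show ?thesis
  proof cases
    case 1
    then show ?thesis by (simp add: pd_basis_notin pd_wedge_free)
  next
    case 2
    from basis_split[OF 2(1)] obtain c S'
      where S': "n |\<notin>| S'" "basis S = fscale c (xi n \<odot> basis S')" by metis
    then show ?thesis using 2
      by (simp add: pd_basis_notin pd_wedge_free wedge_assoc pd_xi_wedge_basis)
  next
    case 3
    from basis_split[OF 3(2)] obtain c T'
      where T': "n |\<notin>| T'" "basis T = fscale c (xi n \<odot> basis T')" by metis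
    then show ?thesis using 3
      by (simp add: pd_basis_notin pd_wedge_free basis_wedge_xi_wedge pd_xi_wedge_basis mult.commute)
  next
    case 4
    from basis_split[OF 4(1)] obtain c S'
      where S': "n |\<notin>| S'" "fcard S = Suc (fcard S')" "basis S = fscale c (xi n \<odot> basis S')" by metis
    from basis_split[OF 4(2)] obtain d T'
      where T': "n |\<notin>| T'" "basis T = fscale d (xi n \<odot> basis T')" by metis
    show ?thesis using S' T'
      by (simp add: pd_xi_wedge_basis wedge_assoc basis_wedge_xi_wedge fscale_distribs
          mult_ac flip: power_add mult_2)
  qed
qed

definition odd_derivation :: "(ext \<Rightarrow> ext) \<Rightarrow> bool" where
  "odd_derivation D \<longleftrightarrow> flinear D \<and> (\<forall>i. \<forall>u\<in>ext_gr i. D u \<in> ext_gr (i + 1)) \<and>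
     (\<forall>i. \<forall>u\<in>ext_gr i. \<forall>v. D (u \<odot> v) = D u \<odot> v + fscale (koszul 1 i) (u \<odot> D v))"

definition coord_gr :: "('a \<Rightarrow> bit) \<Rightarrow> bit \<Rightarrow> ('a \<Rightarrow>\<^sub>0 complex) set" where
  "coord_gr par i = {v. \<forall>a\<in>Poly_Mapping.keys v. par a = i}"

lemma coord_gr_alt: "coord_gr par i = {v. \<forall>a. par a \<noteq> i \<longrightarrow> Poly_Mapping.lookup v a = 0}"
  by (auto simp: coord_gr_def in_keys_iff)

lemma ext_gr_coord: "ext_gr = coord_gr (\<lambda>S. of_nat (fcard S))"
  by (auto simp: ext_gr_def coord_gr_def fun_eq_iff)

lemma subspace_coord_gr: "free.subspace (coord_gr par i)"
  by (auto simp: free.subspace_def coord_gr_alt lookup_add)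

lemma super_vector_space_coord_gr: "super_vector_space fscale (coord_gr par)"
proof
  show "module.subspace fscale (coord_gr par i)" for i
    by (rule subspace_coord_gr)
  show "coord_gr par 0 \<inter> coord_gr par 1 = {0}"
    by (auto simp: coord_gr_alt intro!: poly_mapping_eqI) (metis bit_not_zero_iff zero_neq_one)
  show "\<exists>a\<in>coord_gr par 0. \<exists>b\<in>coord_gr par 1. v = a + b" for v
  proof -
    let ?p = "\<lambda>i. lin_ext (\<lambda>a. if par a = i then basis a else 0) v"
    have lookup: "Poly_Mapping.lookup (?p i) a = (if par a = i then Poly_Mapping.lookup v a else 0)"
      for i a
    proof -
      have "Poly_Mapping.lookup (?p i) a = (\<Sum>b\<in>Poly_Mapping.keys v.
          if b = a then (if par a = i then Poly_Mapping.lookup v a else 0) else 0)"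
        by (subst lookup_lin_ext[OF finite_keys subset_refl], rule sum.cong) (auto simp: lookup_basis)
      then show ?thesis by (simp add: in_keys_iff)
    qed
    have "?p 0 \<in> coord_gr par 0" "?p 1 \<in> coord_gr par 1"
      by (auto simp: coord_gr_alt lookup)
    moreover have "v = ?p 0 + ?p 1"
      by (rule poly_mapping_eqI) (auto simp: lookup lookup_add)
    ultimately show ?thesis by blast
  qed
qed

lemma lin_ext_in_subspace:
  assumes "free.subspace A" "\<And>a. a \<in> Poly_Mapping.keys v \<Longrightarrow> f a \<in> A"
  shows "lin_ext f v \<in> A"
  unfolding lin_ext_def using assms by (intro free.subspace_sum free.subspace_scale)

lemma basis_in_coord_gr [simp]: "basis a \<in> coord_gr par i \<longleftrightarrow> par a = i"
  by (auto simp: coord_gr_alt lookup_basis)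

lemma fscale_in_coord_gr: "v \<in> coord_gr par i \<Longrightarrow> fscale c v \<in> coord_gr par i"
  by (auto simp: coord_gr_alt)

lemma zero_in_coord_gr [simp]: "0 \<in> coord_gr par i"
  by (auto simp: coord_gr_alt)

lemma bit_of_nat_Suc: "of_nat (Suc n) = of_nat n + (1::bit)"
  by (simp add: add.commute)

lemma bit_shift [simp]: "(i + 1 + 1 :: bit) = i"
  by (cases i) auto

lemma koszul_of_nat: "koszul 1 (of_nat n) = (-1) ^ n"
  by (induction n) (auto simp: koszul_def split: if_splits)

lemma odd_derivation_pd: "odd_derivation (pd n)"
  unfolding odd_derivation_def
proof (intro conjI allI ballI)
  show "flinear (pd n)" by (rule flinear_pd)
next
  fix i u
  assume "u \<in> ext_gr i"
  then show "pd n u \<in> ext_gr (i + 1)"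
    unfolding ext_gr_coord pd_def
  proof (intro lin_ext_in_subspace[OF subspace_coord_gr])
    fix S
    assume "u \<in> coord_gr (\<lambda>S. of_nat (fcard S)) i" "S \<in> Poly_Mapping.keys u"
    then have i: "i = of_nat (fcard S)" by (auto simp: coord_gr_def)
    have "fcard S = Suc (fcard (S |-| {|n|}))" if "n |\<in>| S"
      using that by (metis fcard_Suc_fminus1)
    then show "pd_basis n S \<in> coord_gr (\<lambda>S. of_nat (fcard S)) (i + 1)"
      unfolding i pd_basis_def by (auto intro!: fscale_in_coord_gr simp: bit_of_nat_Suc
          simp del: of_nat_Suc)
  qed
next
  fix i u v
  assume u: "u \<in> ext_gr i"
  have "pd n (basis S \<odot> v) =
      pd n (basis S) \<odot> v + fscale ((-1) ^ fcard S) (basis S \<odot> pd n v)" for S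
    by (rule flinear_eqI[where v = v])
      (use pd_derivation_basis[of n S] in
        \<open>simp_all add: flinear_iff fscale_distribs mult.commute add_ac del: wedge_basis_basis pd_basis_basis\<close>)
  note h = this
  show "pd n (u \<odot> v) = pd n u \<odot> v + fscale (koszul 1 i) (u \<odot> pd n v)"
  proof (rule flinear_eq_on_keys[where v = u])
    show "flinear (\<lambda>u. pd n (u \<odot> v))" by (simp add: flinear_iff)
    show "flinear (\<lambda>u. pd n u \<odot> v + fscale (koszul 1 i) (u \<odot> pd n v))"
      by (simp add: flinear_iff fscale_distribs mult.commute add_ac)
    fix S assume "S \<in> Poly_Mapping.keys u"
    then have "i = of_nat (fcard S)" using u by (simp add: ext_gr_def)
    then show "pd n (basis S \<odot> v) =
        pd n (basis S) \<odot> v + fscale (koszul 1 i) (basis S \<odot> pd n v)"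
      by (simp only: koszul_of_nat h)
  qed
qed

lemma xi_in_ext_gr: "xi n \<in> ext_gr 1"
  by (simp add: ext_gr_coord xi_def fcard.rep_eq)

lemma odd_derivation_unique:
  assumes D: "odd_derivation D" and E: "odd_derivation E" and eq: "\<And>m. D (xi m) = E (xi m)"
  shows "D = E"
proof
  fix v
  have one: "F ext_one = 0" if "odd_derivation F" for F
  proof -
    have "ext_one \<in> ext_gr 0" by (simp add: ext_gr_coord ext_one_def fcard.rep_eq)
    then have "F (ext_one \<odot> ext_one) = F ext_one \<odot> ext_one + fscale (koszul 1 0) (ext_one \<odot> F ext_one)"
      using that by (auto simp: odd_derivation_def)
    then show ?thesis by (simp add: ext_one_wedge koszul_def)
  qed
  have lin: "flinear D" "flinear E" using D E by (auto simp: odd_derivation_def)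
  have *: "D (basis S) = E (basis S)" for S
  proof (induction S)
    case empty
    show ?case using one[OF D] one[OF E] by (simp add: ext_one_def)
  next
    case (insert n S)
    obtain c where "basis (finsert n S) = fscale c (xi n \<odot> basis S)"
      using basis_finsert insert.hyps by blast
    moreover have "D (xi n \<odot> basis S) = E (xi n \<odot> basis S)"
      using D E xi_in_ext_gr[of n] insert.IH eq by (auto simp: odd_derivation_def)
    ultimately show ?case using lin by (simp add: flinear_iff)
  qed
  show "D v = E v" by (rule flinear_eqI[OF lin *])
qed

lemma pd_unique:
  assumes "odd_derivation D" "\<And>m. D (xi m) = (if m = n then ext_one else 0)"
  shows "D = pd n"
  using assms odd_derivation_pd by (intro odd_derivation_unique) (auto simp: pd_xi)

lemma pd_xi_wedge: "pd n (xi m \<odot> v) = (if m = n then v else 0) - xi m \<odot> pd n v"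
  using odd_derivation_pd[of n] xi_in_ext_gr[of m]
  by (auto simp: odd_derivation_def pd_xi ext_one_wedge koszul_def fscale_distribs)

lemma wedge_minus [simp]: "u \<odot> (- v) = - (u \<odot> v)" "(- u) \<odot> v = - (u \<odot> v)"
  and pd_minus [simp]: "pd n (- v) = - pd n v" "pd n (u - v) = pd n u - pd n v"
proof -
  show m: "u \<odot> (- v) = - (u \<odot> v)" "(- u) \<odot> v = - (u \<odot> v)" "pd n (- v) = - pd n v" for u v
    using wedge_linear(4)[of u "-1" v] wedge_linear(3)[of "-1" u v] pd_linear(2)[of n "-1" v]
    by simp_all
  show "pd n (u - v) = pd n u - pd n v"
    using pd_linear(1)[of n u "- v"] m(3) by simp
qed

lemma pd_anticommute: "pd m (pd n v) + pd n (pd m v) = 0"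
proof -
  define E where "E v = pd m (pd n v) + pd n (pd m v)" for v
  have lin: "flinear E"
    by (simp add: E_def flinear_iff fscale_distribs add_ac)
  have xi: "E (xi k \<odot> w) = xi k \<odot> E w" for k w
    by (simp add: E_def pd_xi_wedge)
  have "E (basis S) = 0" for S
  proof (induction S)
    case empty
    have "pd k (basis {||}) = 0" for k by (rule pd_basis_notin) simp
    then show ?case by (simp only: E_def pd_linear add_0)
  next
    case (insert k S)
    obtain c where c: "basis (finsert k S) = fscale c (xi k \<odot> basis S)"
      using basis_finsert insert.hyps by blast
    have "E (fscale c (xi k \<odot> basis S)) = fscale c (E (xi k \<odot> basis S))"
      using lin by (simp only: flinear_iff)
    then show ?case by (simp only: c xi insert.IH wedge_linear fscale_simps)
  qed
  then have "E v = 0" by (rule flinear_eqI[OF lin flinear_zero])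
  then show ?thesis by (simp only: E_def)
qed


section \<open>The Fermion algebra is a Lie superalgebra and acts on the Fock module\<close>

fun fermion_par :: "fermion_basis \<Rightarrow> bit" where
  "fermion_par (Psi k) = 1" | "fermion_par Zc = 0"

lemma fermion_gr_coord: "fermion_gr = coord_gr fermion_par"
proof (intro ext set_eqI)
  fix i x
  have *: "(\<forall>a. P a) \<longleftrightarrow> (\<forall>k. P (Psi k)) \<and> P Zc" for P
    by (metis fermion_basis.exhaust)
  show "x \<in> fermion_gr i \<longleftrightarrow> x \<in> coord_gr fermion_par i"
    by (cases i) (auto simp: fermion_gr_def coord_gr_alt *)
qed

lemma bilin_eq_on_keys:
  assumes "\<And>w. flinear (\<lambda>v. F v w)" "\<And>v. flinear (F v)"
    and "\<And>w. flinear (\<lambda>v. G v w)" "\<And>v. flinear (G v)"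
    and "\<And>a b. a \<in> Poly_Mapping.keys v \<Longrightarrow> b \<in> Poly_Mapping.keys w \<Longrightarrow>
      F (basis a) (basis b) = G (basis a) (basis b)"
  shows "F v w = G v w"
  by (rule flinear_eq_on_keys[where v = v], fact, fact, rule flinear_eq_on_keys[where v = w])
    (use assms in auto)

lemma half_add_zero: "half m = - half n \<longleftrightarrow> m = - n - 1"
proof -
  have "half m = - half n \<longleftrightarrow> (of_int m :: rat) = of_int (- n - 1)"
    unfolding half_def of_int_diff of_int_minus of_int_1 by linarith
  then show ?thesis by (simp only: of_int_eq_iff)
qed

lemma flinear_fermion_br: "flinear (fermion_br x)" "flinear (\<lambda>x. fermion_br x y)"
  unfolding fermion_br_def by (rule flinear_bilin_ext)+

lemmas fermion_br_linear [simp] =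
  flinear_fermion_br[unfolded flinear_iff, THEN conjunct1, rule_format]
  flinear_fermion_br[unfolded flinear_iff, THEN conjunct2, rule_format]

lemma fermion_br_0 [simp]: "fermion_br x 0 = 0" "fermion_br 0 x = 0"
  using flinear_fermion_br[THEN flinear_0] by auto

lemma fermion_br_basis_basis [simp]: "fermion_br (basis a) (basis b) = fermion_br_basis a b"
  by (simp add: fermion_br_def)

lemma fermion_br_zc [simp]: "fermion_br x zc = 0" "fermion_br zc x = 0"
proof -
  show "fermion_br x zc = 0"
  proof (rule flinear_eqI[where v = x])
    show "fermion_br (basis a) zc = 0" for a by (cases a) auto
  qed (auto simp: flinear_iff)
  show "fermion_br zc x = 0"
  proof (rule flinear_eqI[where v = x])
    show "fermion_br zc (basis a) = 0" for a by (cases a) auto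
  qed (auto simp: flinear_iff)
qed

lemma fermion_br_br: "fermion_br x (fermion_br y w) = 0" "fermion_br (fermion_br x y) w = 0"
proof -
  have b: "fermion_br_basis a b = 0 \<or> fermion_br_basis a b = zc" for a b
    by (cases a; cases b) auto
  have "fermion_br x (fermion_br_basis a b) = 0" "fermion_br (fermion_br_basis a b) x = 0" for x a b
    using b[of a b] by auto
  then show "fermion_br x (fermion_br y w) = 0" "fermion_br (fermion_br x y) w = 0"
    by - (rule bilin_eq_on_keys[where G = "\<lambda>_ _. 0"]; simp add: flinear_iff)+
qed

lemma koszul_simps [simp]: "koszul 1 1 = -1" "koszul 0 i = 1" "koszul i 0 = 1"
  by (auto simp: koszul_def)

theorem fermion_lie_superalgebra: "lie_superalgebra fscale fermion_gr fermion_br"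
proof -
  interpret super_vector_space fscale fermion_gr
    unfolding fermion_gr_coord by (rule super_vector_space_coord_gr)
  show ?thesis
  proof (rule lie_superalgebra.intro[OF super_vector_space_axioms], rule lie_superalgebra_axioms.intro)
    show "flinear (\<lambda>x. fermion_br x y)" "flinear (fermion_br x)" for x y
      by (rule flinear_fermion_br)+
  next
    fix x y i j
    assume x: "x \<in> fermion_gr i" and y: "y \<in> fermion_gr j"
    have *: "fermion_br_basis a b \<in> coord_gr fermion_par (i + j)"
      if "a \<in> Poly_Mapping.keys x" "b \<in> Poly_Mapping.keys y" for a b
      using x y that by (cases a; cases b) (auto simp: fermion_gr_coord coord_gr_def[of _ i] coord_gr_def[of _ j])
    show "fermion_br x y \<in> fermion_gr (i + j)"
      unfolding fermion_gr_coord fermion_br_def bilin_ext_def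
      by (intro lin_ext_in_subspace subspace_coord_gr *)
    show "fermion_br x y = - fscale (koszul i j) (fermion_br y x)"
    proof (rule bilin_eq_on_keys[where v = x and w = y])
      fix a b assume "a \<in> Poly_Mapping.keys x" "b \<in> Poly_Mapping.keys y"
      then have "fermion_par a = i" "fermion_par b = j"
        using x y by (auto simp: fermion_gr_coord coord_gr_def)
      then show "fermion_br (basis a) (basis b) = - fscale (koszul i j) (fermion_br (basis b) (basis a))"
        by (cases a; cases b) (auto simp: half_add_zero fscale_distribs)
    qed (auto simp: flinear_iff fscale_distribs mult.commute)
    show "fermion_br x (fermion_br y w) =
        fermion_br (fermion_br x y) w + fscale (koszul i j) (fermion_br y (fermion_br x w))" for w
      by (simp add: fermion_br_br)
  qed
qed

lemma flinear_fock_basis: "flinear (fock_basis b)"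
  by (cases b) (auto simp: flinear_iff)

lemma flinear_fock_act: "flinear (fock_act x)" "flinear (\<lambda>x. fock_act x v)"
  unfolding fock_act_def by (auto intro: flinear_lin_ext_fun flinear_fock_basis)

lemmas fock_act_linear [simp] =
  flinear_fock_act[unfolded flinear_iff, THEN conjunct1, rule_format]
  flinear_fock_act[unfolded flinear_iff, THEN conjunct2, rule_format]

lemma fock_act_basis [simp]: "fock_act (basis b) v = fock_basis b v"
  by (simp add: fock_act_def)

lemma fock_act_0 [simp]: "fock_act 0 v = 0"
  using flinear_fock_act(2) by (rule flinear_0)

lemma xi_wedge_graded: "v \<in> ext_gr j \<Longrightarrow> xi n \<odot> v \<in> ext_gr (1 + j)"
proof -
  assume v: "v \<in> ext_gr j"
  have "xi n \<odot> v = lin_ext (wedge_basis {|n|}) v"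
    by (simp add: xi_def wedge_def bilin_ext_def)
  moreover have "wedge_basis {|n|} S \<in> ext_gr (1 + j)" if "S \<in> Poly_Mapping.keys v" for S
    using v that unfolding ext_gr_coord
    by (auto simp: coord_gr_def[of _ j] wedge_basis_def fcard_finsert_disjoint
        intro!: fscale_in_coord_gr)
  ultimately show ?thesis
    unfolding ext_gr_coord by (metis lin_ext_in_subspace subspace_coord_gr)
qed

lemma fock_clifford:
  "fock_basis (Psi m) (fock_basis (Psi n) v) + fock_basis (Psi n) (fock_basis (Psi m) v) =
     (if m = - n - 1 then v else 0)"
proof -
  have xx: "xi k \<odot> (xi l \<odot> v) + xi l \<odot> (xi k \<odot> v) = 0" for k l
    by (metis xi_anticommute add.left_inverse wedge_assoc wedge_linear(1,5))
  show ?thesis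
    by (auto simp: pd_anticommute xx pd_xi_wedge)
qed

theorem fock_module: "fermion_module fscale ext_gr fock_act"
proof -
  interpret L: lie_superalgebra fscale fermion_gr fermion_br
    by (rule fermion_lie_superalgebra)
  interpret M: super_vector_space fscale ext_gr
    unfolding ext_gr_coord by (rule super_vector_space_coord_gr)
  show ?thesis
  proof (rule lie_supermodule.intro[OF L.lie_superalgebra_axioms M.super_vector_space_axioms],
      rule lie_supermodule_axioms.intro)
    show "flinear (\<lambda>x. fock_act x v)" "flinear (fock_act x)" for x v
      by (rule flinear_fock_act)+
  next
    fix x v i j
    assume x: "x \<in> fermion_gr i" and v: "v \<in> ext_gr j"
    show "fock_act x v \<in> ext_gr (i + j)"
      unfolding fock_act_def
    proof (rule lin_ext_in_subspace)
      fix b assume "b \<in> Poly_Mapping.keys x"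
      then have "fermion_par b = i" using x by (auto simp: fermion_gr_coord coord_gr_def)
      then show "fock_basis b v \<in> ext_gr (i + j)"
        using v odd_derivation_pd xi_wedge_graded[OF v]
        by (cases b) (auto simp: odd_derivation_def add.commute)
    qed (simp add: ext_gr_coord subspace_coord_gr)
  next
    fix x y v i j
    assume x: "x \<in> fermion_gr i" and y: "y \<in> fermion_gr j"
    show "fock_act (fermion_br x y) v =
        fock_act x (fock_act y v) - fscale (koszul i j) (fock_act y (fock_act x v))"
    proof (rule bilin_eq_on_keys[where v = x and w = y])
      fix a b assume "a \<in> Poly_Mapping.keys x" "b \<in> Poly_Mapping.keys y"
      then have "fermion_par a = i" "fermion_par b = j"
        using x y by (auto simp: fermion_gr_coord coord_gr_def)
      then show "fock_act (fermion_br (basis a) (basis b)) v = fock_act (basis a) (fock_act (basis b) v)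
          - fscale (koszul i j) (fock_act (basis b) (fock_act (basis a) v))"
        using fock_clifford
        by (cases a; cases b)
          (auto simp: half_add_zero fscale_distribs simp del: fock_basis.simps(1))
    qed (auto simp: flinear_iff fscale_distribs mult.commute algebra_simps)
  qed
qed

lemma sigma_fermion_br: "sigma \<mu> (fermion_br x y) = fermion_br (sigma \<mu> x) (sigma \<mu> y)"
proof (rule bilin_eq_on_keys[where v = x and w = y])
  show "sigma \<mu> (fermion_br (basis a) (basis b)) =
      fermion_br (sigma \<mu> (basis a)) (sigma \<mu> (basis b))" for a b
    using flinear_0[OF flinear_lin_ext]
    by (cases a; cases b) (auto simp: sigma_def power2_eq_square)
qed (auto simp: flinear_iff sigma_def)

lemma sigma_graded: "x \<in> fermion_gr i \<Longrightarrow> sigma \<mu> x \<in> fermion_gr i"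
  unfolding sigma_def fermion_gr_coord
proof (rule lin_ext_in_subspace[OF subspace_coord_gr])
  show "sigma_basis \<mu> a \<in> coord_gr fermion_par i"
    if "x \<in> coord_gr fermion_par i" "a \<in> Poly_Mapping.keys x" for a
    using that by (cases a) (auto simp: coord_gr_def[of _ i] in_keys_iff lookup_basis split: if_splits)
qed

theorem twist_module:
  fixes scale :: "complex \<Rightarrow> 'v::ab_group_add \<Rightarrow> 'v"
  assumes "fermion_module scale gr act"
  shows "fermion_module scale gr (twist \<mu> act)"
proof -
  interpret V: lie_supermodule fscale fermion_gr fermion_br scale gr act by fact
  show ?thesis
  proof (rule lie_supermodule.intro[OF V.L.lie_superalgebra_axioms V.M.super_vector_space_axioms],
      rule lie_supermodule_axioms.intro)
    show "Vector_Spaces.linear fscale scale (\<lambda>x. twist \<mu> act x v)" for v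
      using V.act_linear_left[of v] flinear_lin_ext[of "sigma_basis \<mu>"]
      unfolding module_hom_iff_linear[symmetric] module_hom_iff twist_def sigma_def by auto
    show "Vector_Spaces.linear scale scale (twist \<mu> act x)" for x
      using V.act_linear_right by (simp add: twist_def[abs_def])
    show "twist \<mu> act x v \<in> gr (i + j)" if "x \<in> fermion_gr i" "v \<in> gr j" for x v i j
      using that by (simp only: twist_def V.act_graded sigma_graded)
    show "twist \<mu> act (fermion_br x y) v = twist \<mu> act x (twist \<mu> act y v) -
        scale (koszul i j) (twist \<mu> act y (twist \<mu> act x v))"
      if "x \<in> fermion_gr i" "y \<in> fermion_gr j" for x y v i j
      using that by (simp add: twist_def sigma_fermion_br V.act_bracket sigma_graded)
  qed
qed

end

theory Submission
  imports Defs
begin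

text \<open>By smoothness only finitely many annihilation operators \<open>\<psi>\<^sub>n\<close> with \<open>n > 0\<close> act nontrivially
  on a given vector. As they anticommute and square to zero, applying those that do not kill
  the vector produces a homogeneous vacuum \<open>v\<^sub>0 \<noteq> 0\<close>. With \<open>\<mu>\<^sup>2 = \<lambda>\<close>, sending a monomial in the
  \<open>\<xi>\<^sub>n\<close> to the corresponding product of the \<open>\<mu>\<inverse> \<psi>\<^bsub>-n\<^esub>\<close> applied to \<open>v\<^sub>0\<close> is equivariant, hence onto
  by simplicity. Every nonzero subspace of the exterior algebra that is closed under the \<open>\<partial>\<^sub>n\<close>
  contains \<open>1\<close>, again by the vacuum argument, and \<open>1\<close> is not in the kernel.\<close>

section \<open>Joint kernels of square-zero operators\<close>

text \<open>Induction on \<open>N\<close>. If \<open>a N\<close> kills \<open>v\<close>, the bound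
  drops; otherwise \<open>a N v\<close> replaces \<open>v\<close>, since \<open>a N\<close> squares
  to zero and the higher operators still vanish there. \<open>P\<close> is an invariant: membership
  in a kernel in one use, homogeneity in the other.\<close>

lemma common_kernel:
  fixes a :: "nat \<Rightarrow> 'v::zero \<Rightarrow> 'v"
  assumes "\<And>n v. a n (a n v) = 0"
    and "\<And>m n v. a m v = 0 \<Longrightarrow> a m (a n v) = 0"
    and "\<And>n v. P v \<Longrightarrow> P (a n v)"
    and "P v" "v \<noteq> 0" "\<And>k. k \<ge> N \<Longrightarrow> a k v = 0"
  shows "\<exists>w. P w \<and> w \<noteq> 0 \<and> (\<forall>k. a k w = 0)"
  using assms(4-6)
proof (induction N arbitrary: v)
  case 0
  then show ?case by auto
next
  case (Suc N)
  show ?case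
  proof (cases "a N v = 0")
    case True
    then show ?thesis using Suc by (metis le_antisym not_less_eq_eq)
  next
    case False
    have "a k (a N v) = 0" if "k \<ge> N" for k
      using that Suc.prems(3) assms(1,2) by (cases "k = N") auto
    then show ?thesis using Suc.IH[of "a N v"] False assms(3) Suc.prems(1) by blast
  qed
qed

section \<open>Linear maps out of free vector spaces\<close>

lemma linear_iff_add_scale:
  assumes "vector_space s1" "vector_space s2"
  shows "Vector_Spaces.linear s1 s2 f \<longleftrightarrow>
    (\<forall>v w. f (v + w) = f v + f w) \<and> (\<forall>c v. f (s1 c v) = s2 c (f v))"
  using assms unfolding module_hom_iff_linear[symmetric] module_hom_iff
  by (simp add: module_iff_vector_space)

lemma double_eq_zeroD:
  fixes s :: "complex \<Rightarrow> 'v::ab_group_add \<Rightarrow> 'v" and w :: 'v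
  assumes "vector_space s" "w + w = 0"
  shows "w = 0"
proof -
  interpret vector_space s by fact
  show ?thesis
    using assms(2) scale_left_distrib[of 1 1 w] by simp
qed

text \<open>The basis vectors span. In contrast to \<open>flinear_eqI\<close>, the target may be any
  complex vector space, such as the given module.\<close>

lemma linear_eq_on_basis:
  assumes f: "Vector_Spaces.linear fscale s f" and g: "Vector_Spaces.linear fscale s g"
    and eq: "\<And>a. f (basis a) = g (basis a)"
  shows "f v = g v"
proof -
  interpret vector_space_pair fscale s
    using f free.vector_space_axioms by (auto simp: vector_space_pair_def Vector_Spaces.linear_def)
  have "v \<in> free.span (range basis)"
    by (subst basis_expansion, rule lin_ext_in_subspace) (auto intro: free.span_base)
  then show ?thesis
    using linear_eq_on_span[OF f g] eq by blast
qed

text \<open>The counterpart of \<open>lin_ext\<close> for a target that need not be free.\<close>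

lemma linear_basis_extension:
  assumes "vector_space s"
  shows "Vector_Spaces.linear fscale s
    (\<lambda>v. \<Sum>a\<in>Poly_Mapping.keys v. s (Poly_Mapping.lookup v a) (m a))"
proof -
  interpret vector_space s by fact
  \<comment> \<open>The index set varies with the vector, so all sums are first extended by zero
    terms to one common finite set.\<close>
  have ext: "(\<Sum>a\<in>Poly_Mapping.keys v. s (Poly_Mapping.lookup v a) (m a)) =
      (\<Sum>a\<in>A. s (Poly_Mapping.lookup v a) (m a))"
    if "finite A" "Poly_Mapping.keys v \<subseteq> A" for A v
    by (rule sum.mono_neutral_left) (use that in \<open>auto simp: in_keys_iff\<close>)
  show ?thesis
    unfolding linear_iff_add_scale[OF free.vector_space_axioms vector_space_axioms]
  proof (intro conjI allI)
    fix v w :: "'b \<Rightarrow>\<^sub>0 complex" and c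
    let ?A = "Poly_Mapping.keys v \<union> Poly_Mapping.keys w"
    have A: "finite ?A" "Poly_Mapping.keys v \<subseteq> ?A" "Poly_Mapping.keys w \<subseteq> ?A"
      "Poly_Mapping.keys (v + w) \<subseteq> ?A" "Poly_Mapping.keys (fscale c v) \<subseteq> ?A"
      by (auto simp: in_keys_iff lookup_add)
    show "(\<Sum>a\<in>Poly_Mapping.keys (v + w). s (Poly_Mapping.lookup (v + w) a) (m a)) =
      (\<Sum>a\<in>Poly_Mapping.keys v. s (Poly_Mapping.lookup v a) (m a)) +
      (\<Sum>a\<in>Poly_Mapping.keys w. s (Poly_Mapping.lookup w a) (m a))"
      unfolding ext[OF A(1,2)] ext[OF A(1,3)] ext[OF A(1,4)]
      by (simp add: lookup_add scale_left_distrib sum.distrib)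
    show "(\<Sum>a\<in>Poly_Mapping.keys (fscale c v). s (Poly_Mapping.lookup (fscale c v) a) (m a)) =
      s c (\<Sum>a\<in>Poly_Mapping.keys v. s (Poly_Mapping.lookup v a) (m a))"
      unfolding ext[OF A(1,2)] ext[OF A(1,5)] by (simp add: scale_sum_right)
  qed
qed

section \<open>Vacuum vectors in the exterior algebra\<close>

text \<open>Among the sets containing \<open>n\<close>, only \<open>S\<close> yields
  \<open>S |-| {|n|}\<close> when \<open>n\<close> is removed, so one term survives.\<close>

lemma lookup_pd:
  assumes "n |\<in>| S"
  shows "Poly_Mapping.lookup (pd n u) (S |-| {|n|}) =
    (-1) ^ card {s. s |\<in>| S \<and> s < n} * Poly_Mapping.lookup u S"
proof -
  have inj: "T = S" if "n |\<in>| T" "T |-| {|n|} = S |-| {|n|}" for T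
    using that assms by (metis finsert_fminus)
  \<comment> \<open>Inserting \<open>S\<close> keeps its term in the sum even when its coefficient
    in \<open>u\<close> is zero.\<close>
  have "Poly_Mapping.lookup (pd n u) (S |-| {|n|}) =
      (\<Sum>T\<in>insert S (Poly_Mapping.keys u).
        Poly_Mapping.lookup u T * Poly_Mapping.lookup (pd_basis n T) (S |-| {|n|}))"
    unfolding pd_def by (rule lookup_lin_ext) auto
  also have "\<dots> = (\<Sum>T\<in>{S}.
        Poly_Mapping.lookup u T * Poly_Mapping.lookup (pd_basis n T) (S |-| {|n|}))"
    by (rule sum.mono_neutral_right) (auto simp: pd_basis_def lookup_basis dest: inj)
  finally show ?thesis
    using assms by (simp add: pd_basis_def lookup_basis)
qed

text \<open>A nonempty \<open>S\<close> contains some \<open>n\<close>, and its coefficient in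
  \<open>u\<close> is up to sign a coefficient of \<open>pd n u\<close>.\<close>

lemma pd_vacuum:
  assumes "\<And>n. pd n u = 0"
  shows "u = fscale (Poly_Mapping.lookup u {||}) ext_one"
proof (rule poly_mapping_eqI)
  fix S
  show "Poly_Mapping.lookup u S =
    Poly_Mapping.lookup (fscale (Poly_Mapping.lookup u {||}) ext_one) S"
  proof (cases "S = {||}")
    case False
    then obtain n where n: "n |\<in>| S" by auto
    have "Poly_Mapping.lookup u S = 0"
      using lookup_pd[OF n, of u] assms by simp
    then show ?thesis using False by (simp add: ext_one_def lookup_basis)
  qed (simp add: ext_one_def lookup_basis)
qed

text \<open>Only finitely many generators occur in \<open>u\<close>. This supplies the bound for
  \<open>common_kernel\<close>.\<close>

lemma pd_eventually_zero: "\<exists>N. \<forall>n\<ge>N. pd n u = 0"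
proof -
  have fin: "finite (\<Union>S\<in>Poly_Mapping.keys u. fset S)" by simp
  then obtain N where N: "\<And>n. n \<in> (\<Union>S\<in>Poly_Mapping.keys u. fset S) \<Longrightarrow> n < N"
    by (metis finite_nat_set_iff_bounded)
  have "pd n u = 0" if "n \<ge> N" for n
  proof (rule flinear_eq_on_keys[OF flinear_pd flinear_zero])
    fix S assume "S \<in> Poly_Mapping.keys u"
    then have "n |\<notin>| S" using N that by (meson UN_I not_le)
    then show "pd n (basis S) = 0" by (rule pd_basis_notin)
  qed
  then show ?thesis by blast
qed

lemma pd_pd_zero: "pd n (pd n v) = 0"
  using double_eq_zeroD[OF free.vector_space_axioms pd_anticommute] .

text \<open>A nonzero kernel would contain a nonzero vector killed by every \<open>pd k\<close>.
  That vector is a multiple of \<open>ext_one\<close>, which \<open>f\<close> does not kill.\<close>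

lemma flinear_kernel_vacuum:
  assumes f: "Vector_Spaces.linear fscale s f"
    and kernel: "\<And>n u. f u = 0 \<Longrightarrow> f (pd n u) = 0" and one: "f ext_one \<noteq> 0" and "f u = 0"
  shows "u = 0"
proof (rule ccontr)
  assume "u \<noteq> 0"
  interpret vector_space_pair fscale s
    using f free.vector_space_axioms by (auto simp: vector_space_pair_def Vector_Spaces.linear_def)
  have comm: "pd m (pd n v) = 0" if "pd m v = 0" for m n v
    using pd_anticommute[of m n v] that by simp
  obtain N where "\<And>n. n \<ge> N \<Longrightarrow> pd n u = 0" using pd_eventually_zero by blast
  then obtain w where w: "f w = 0" "w \<noteq> 0" "\<And>k. pd k w = 0"
    using common_kernel[of pd "\<lambda>u. f u = 0" u N] pd_pd_zero comm kernel \<open>u \<noteq> 0\<close> \<open>f u = 0\<close>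
    by blast
  have "s (Poly_Mapping.lookup w {||}) (f ext_one) = 0"
    using pd_vacuum[OF w(3)] w(1) linear_scale[OF f] by metis
  then show False
    using one w(2) pd_vacuum[OF w(3)] by (metis fscale_simps(2) vs2.scale_eq_0_iff)
qed

section \<open>Parity shifts, isomorphisms and simplicity\<close>

lemma bit_double [simp]: "p + p = (0::bit)" "i + p + p = (i::bit)"
  by (cases p; cases i; simp)+

text \<open>The two homogeneous parts of the target meet in \<open>0\<close>, so an injective map respecting the
  grading also reflects it.\<close>

lemma supermodule_isomorphicI:
  assumes M: "super_vector_space s1 gr1" "super_vector_space s2 gr2"
    and F: "Vector_Spaces.linear s1 s2 F" "bij F"
    and gr: "\<And>i u. u \<in> gr1 i \<Longrightarrow> F u \<in> gr2 (i + p)"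
    and act: "\<And>x u. F (act1 x u) = act2 x (F u)"
  shows "supermodule_isomorphic s2 gr2 act2 s1 gr1 act1"
proof -
  interpret M1: super_vector_space s1 gr1 by fact
  interpret M2: super_vector_space s2 gr2 by fact
  have lin: "F (u + v) = F u + F v" "F (s1 c u) = s2 c (F u)" for u v c
    using F(1) linear_iff_add_scale[OF M1.vector_space_axioms M2.vector_space_axioms] by blast+
  define G where "G = inv F"
  have FG: "F (G v) = v" and GF: "G (F u) = u" for u v
    using F(2) by (simp_all add: G_def bij_inv_eq_iff bij_is_surj surj_f_inv_f bij_is_inj)
  have G_lin: "Vector_Spaces.linear s2 s1 G"
    unfolding linear_iff_add_scale[OF M2.vector_space_axioms M1.vector_space_axioms]
    by (metis lin FG GF)
  have "bij G" using F(2) by (simp add: G_def bij_imp_bij_inv)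
  have M1_decomp: "\<exists>a\<in>gr1 i. \<exists>b\<in>gr1 (i + 1). u = a + b" for u i
    using M1.gr_decomp[of u] by (cases i) (auto, metis add.commute)
  have disjoint: "v = 0" if "v \<in> gr2 i" "v \<in> gr2 (i + 1)" for v i
    using that M2.gr_disjoint by (cases i) auto
  have reflect: "u \<in> gr1 i" if "F u \<in> gr2 (i + p)" for u i
  proof -
    obtain a b where ab: "a \<in> gr1 i" "b \<in> gr1 (i + 1)" "u = a + b"
      using M1_decomp by blast
    have "F b = F u - F a" by (simp add: ab lin)
    then have "F b \<in> gr2 (i + p)"
      using that gr[OF ab(1)] M2.gr_subspace M2.subspace_diff by metis
    moreover have "F b \<in> gr2 (i + p + 1)"
      using gr[OF ab(2)] by (simp only: ac_simps)
    ultimately have "F b = 0" by (rule disjoint)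
    moreover have "F 0 = 0" using lin(1)[of 0 0] by simp
    ultimately have "b = 0" using GF by metis
    then show ?thesis using ab by simp
  qed
  \<comment> \<open>The inverse shifts parity by the same \<open>p\<close>, because
    \<open>p + p = 0\<close>.\<close>
  have "G ` gr2 i = gr1 (i + p)" for i
  proof (intro equalityI subsetI)
    fix u assume "u \<in> G ` gr2 i"
    then have "F u \<in> gr2 i" using FG by auto
    then have "F u \<in> gr2 (i + p + p)" by (simp only: bit_double)
    then show "u \<in> gr1 (i + p)" by (rule reflect)
  next
    fix u assume "u \<in> gr1 (i + p)"
    then have "F u \<in> gr2 (i + p + p)" by (rule gr)
    then have "F u \<in> gr2 i" by (simp only: bit_double)
    then show "u \<in> G ` gr2 i" using GF by (metis image_eqI)
  qed
  moreover have "G (act2 x v) = act1 x (G v)" for x v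
    by (metis act FG GF)
  ultimately show ?thesis
    unfolding supermodule_isomorphic_def using G_lin \<open>bij G\<close> by blast
qed

text \<open>The image is a graded submodule, nonzero because of \<open>u0\<close>.\<close>

lemma surj_if_simple:
  assumes M: "super_vector_space s1 gr1" "super_vector_space s2 gr2"
    and simple: "simple_supermodule s2 gr2 act2"
    and F: "Vector_Spaces.linear s1 s2 F" "F u0 \<noteq> 0"
    and gr: "\<And>i u. u \<in> gr1 i \<Longrightarrow> F u \<in> gr2 (i + p)"
    and act: "\<And>x u. F (act1 x u) = act2 x (F u)"
  shows "surj F"
proof -
  interpret M1: super_vector_space s1 gr1 by fact
  interpret M2: super_vector_space s2 gr2 by fact
  interpret vector_space_pair s1 s2 ..
  have "\<exists>a\<in>range F \<inter> gr2 0. \<exists>b\<in>range F \<inter> gr2 1. F u = a + b" for u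
  proof -
    obtain a b where ab: "a \<in> gr1 0" "b \<in> gr1 1" "u = a + b"
      using M1.gr_decomp by blast
    \<comment> \<open>An odd \<open>F\<close> exchanges the even and odd summands, so the sum is
      recorded in both orders.\<close>
    have sum: "F u = F a + F b" "F u = F b + F a"
      using linear_add[OF F(1)] ab(3) by (simp_all add: add.commute)
    have "F a \<in> gr2 0 \<and> F b \<in> gr2 1 \<or> F a \<in> gr2 1 \<and> F b \<in> gr2 0"
      using gr[OF ab(1)] gr[OF ab(2)] by (cases p) simp_all
    then show ?thesis using sum by blast
  qed
  moreover have "M2.subspace (range F)"
    using linear_subspace_image[OF F(1)] M1.subspace_UNIV by blast
  ultimately have "graded_submodule s2 gr2 act2 (range F)"
    unfolding graded_submodule_def by (auto simp flip: act)
  then have "range F = {0} \<or> range F = UNIV"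
    using simple by (simp add: simple_supermodule_def)
  then show ?thesis using F(2) by blast
qed

section \<open>Clifford relations and vacuum vectors in a Fermion module\<close>

locale clifford_module =
  lie_supermodule fscale fermion_gr fermion_br scale gr act
  for scale :: "complex \<Rightarrow> 'v::ab_group_add \<Rightarrow> 'v" and gr act +
  fixes \<mu> :: complex
  assumes mu: "\<mu> \<noteq> 0" and central: "act zc v = scale (\<mu>^2) v"
begin

lemma act_linear [simp]:
  "act x (v + w) = act x v + act x w" "act x (scale c v) = scale c (act x v)" "act x 0 = 0"
proof -
  show 1: "act x (v + w) = act x v + act x w" "act x (scale c v) = scale c (act x v)"
    for v w c
    using act_linear_right[of x] linear_iff_add_scale[OF M.vector_space_axioms M.vector_space_axioms] by blast+
  show "act x 0 = 0" using 1(1)[of 0 0] by simp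
qed

lemma act_minus [simp]: "act x (- v) = - act x v"
  using act_linear(1)[of x v "- v"] by (simp add: eq_neg_iff_add_eq_0 add.commute)

lemma psi_odd: "psi k \<in> fermion_gr 1"
  by (simp add: fermion_gr_coord)

text \<open>Both generators are odd, so the Koszul sign turns the bracket into an anticommutator;
  \<open>k = - l - 1\<close> encodes opposite half-integer indices.\<close>

lemma clifford:
  "act (psi k) (act (psi l) v) + act (psi l) (act (psi k) v) =
     (if k = - l - 1 then scale (\<mu>^2) v else 0)"
proof -
  have "act 0 v = 0"
    using act_linear_left[of v] linear_iff_add_scale[OF L.vector_space_axioms M.vector_space_axioms]
    by (metis M.scale_zero_left fscale_simps(2))
  then show ?thesis
    using act_bracket[OF psi_odd psi_odd, of k l v]
    by (simp add: central half_add_zero split: if_splits)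
qed

lemma ex_vacuum:
  assumes "smooth act" "(UNIV :: 'v set) \<noteq> {0}"
  obtains v p where "v \<in> gr p" "v \<noteq> 0" "\<And>n. act (psi (int n)) v = 0"
proof -
  obtain u :: 'v where "u \<noteq> 0" using assms(2) by blast
  moreover obtain a b where "a \<in> gr 0" "b \<in> gr 1" "u = a + b"
    using M.gr_decomp by blast
  \<comment> \<open>At least one homogeneous component of a nonzero vector is nonzero.\<close>
  ultimately obtain v i where v: "v \<in> gr i" "v \<noteq> 0" by (metis add_0)
  obtain N :: nat where N: "\<And>k. half k > of_nat N \<Longrightarrow> act (psi k) v = 0"
    using assms(1) unfolding smooth_def by blast
  \<comment> \<open>\<open>psi (int n)\<close> has index n + 1/2, which exceeds \<open>N\<close>
    already for n = \<open>N\<close>.\<close>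
  have large: "act (psi (int n)) v = 0" if "n \<ge> N" for n
  proof (rule N)
    have "rat_of_nat N \<le> rat_of_nat n" using that by simp
    then show "half (int n) > of_nat N" by (simp add: half_def)
  qed
  \<comment> \<open>No half-integer is its own negative, so twice the square is zero.\<close>
  have sq: "act (psi (int n)) (act (psi (int n)) w) = 0" for n w
    by (rule double_eq_zeroD[OF M.vector_space_axioms]) (simp add: clifford)
  have comm: "act (psi (int m)) (act (psi (int n)) w) = 0" if "act (psi (int m)) w = 0" for m n w
    using clifford[of "int m" "int n" w] that by simp
  have graded: "\<exists>j. act (psi (int n)) w \<in> gr j" if "\<exists>j. w \<in> gr j" for n w
    using that act_graded[OF psi_odd] by blast
  show thesis
    using common_kernel[of "\<lambda>n. act (psi (int n))" "\<lambda>w. \<exists>j. w \<in> gr j" v N]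
      sq comm graded large v that by blast
qed

end

section \<open>The equivariant map from the Fock module\<close>

locale vacuum_module = clifford_module scale gr act \<mu>
  for scale :: "complex \<Rightarrow> 'v::ab_group_add \<Rightarrow> 'v" and gr act \<mu> +
  fixes vac :: 'v and p :: bit
  assumes vac: "vac \<in> gr p" "vac \<noteq> 0" "act (psi (int n)) vac = 0"
begin

text \<open>Dividing by \<open>\<mu>\<close> here and in \<open>creat\<close> normalises the scalar
  \<open>\<mu>^2\<close> of the Clifford relation to 1.\<close>

definition annih :: "nat \<Rightarrow> 'v \<Rightarrow> 'v" where
  "annih n v = scale (inverse \<mu>) (act (psi (int n)) v)"

definition creat :: "nat \<Rightarrow> 'v \<Rightarrow> 'v" where
  "creat n v = scale (inverse \<mu>) (act (psi (- int n - 1)) v)"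

lemma creat_scale [simp]: "creat n (scale c v) = scale c (creat n v)"
  by (simp add: creat_def mult.commute)

lemma creat_minus [simp]: "creat n (- v) = - creat n v"
  by (simp add: creat_def)

lemma creat_anticommute: "creat m (creat n v) = - creat n (creat m v)"
proof -
  have "creat m (creat n v) + creat n (creat m v) = 0"
    using clifford[of "- int m - 1" "- int n - 1" v]
    by (simp add: creat_def flip: M.scale_right_distrib)
  then show ?thesis by (simp add: eq_neg_iff_add_eq_0)
qed

lemma creat_creat: "creat n (creat n v) = 0"
proof -
  have "creat n (creat n v) + creat n (creat n v) = 0"
    using creat_anticommute[of n n v] by (simp add: eq_neg_iff_add_eq_0)
  then show ?thesis by (rule double_eq_zeroD[OF M.vector_space_axioms])
qed

text \<open>The same relation as \<open>pd_xi_wedge\<close>, which lets \<open>pd\<close> and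
  \<open>annih\<close> be compared by induction.\<close>

lemma annih_creat: "annih m (creat n v) = (if m = n then v else 0) - creat n (annih m v)"
proof -
  have "annih m (creat n v) + creat n (annih m v) =
      scale (inverse \<mu> * inverse \<mu>) (if m = n then scale (\<mu>^2) v else 0)"
    using clifford[of "int m" "- int n - 1" v]
    by (simp add: creat_def annih_def flip: M.scale_right_distrib split: if_splits)
  also have "\<dots> = (if m = n then v else 0)"
    using mu by (simp add: power2_eq_square field_simps)
  finally show ?thesis by (simp add: algebra_simps)
qed

text \<open>The smallest index acts outermost, matching the order of factors in the monomial
  \<open>S\<close>, so no sign appears.\<close>

definition monom_vec :: "nat fset \<Rightarrow> 'v" where
  "monom_vec S = foldr creat (sorted_list_of_set (fset S)) vac"

definition fock_map :: "ext \<Rightarrow> 'v" where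
  "fock_map u = (\<Sum>S\<in>Poly_Mapping.keys u. scale (Poly_Mapping.lookup u S) (monom_vec S))"

lemma linear_fock_map: "Vector_Spaces.linear fscale scale fock_map"
  unfolding fock_map_def[abs_def] by (rule linear_basis_extension) (rule M.vector_space_axioms)

lemma fock_map_linear [simp]:
  "fock_map (u + v) = fock_map u + fock_map v" "fock_map (fscale c u) = scale c (fock_map u)"
  "fock_map 0 = 0" "fock_map (u - v) = fock_map u - fock_map v"
proof -
  interpret vector_space_pair fscale scale ..
  show "fock_map (u + v) = fock_map u + fock_map v" "fock_map (fscale c u) = scale c (fock_map u)"
    "fock_map 0 = 0" "fock_map (u - v) = fock_map u - fock_map v"
    using linear_fock_map linear_add linear_scale linear_0 linear_diff by blast+
qed

lemma fock_map_basis [simp]: "fock_map (basis S) = monom_vec S"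
  by (simp add: fock_map_def basis_def)

lemma fock_map_one: "fock_map ext_one = vac"
  by (simp add: ext_one_def monom_vec_def)

text \<open>Moving \<open>creat n\<close> to the front past each smaller entry costs one
  sign.\<close>

lemma foldr_creat_insort:
  assumes "sorted xs" "n \<notin> set xs"
  shows "foldr creat (insort n xs) v =
    scale ((-1) ^ length (filter (\<lambda>s. s < n) xs)) (creat n (foldr creat xs v))"
  using assms
proof (induction xs)
  case (Cons y ys)
  show ?case
  proof (cases "n \<le> y")
    case True
    then have "filter (\<lambda>s. s < n) (y # ys) = []"
      using Cons.prems by (auto simp: filter_empty_conv)
    then show ?thesis using True by (simp only: insort_key.simps) simp
  next
    case False
    then show ?thesis using Cons
      by (simp add: creat_anticommute[of y n])
  qed
qed simp

text \<open>The entries below \<open>n\<close> are exactly the inversions, so this is the sign used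
  in \<open>wedge_basis\<close>.\<close>

lemma monom_vec_finsert:
  assumes "n |\<notin>| S"
  shows "monom_vec (finsert n S) = scale ((-1) ^ inversions {|n|} S) (creat n (monom_vec S))"
proof -
  let ?xs = "sorted_list_of_set (fset S)"
  have "{(s, t). s |\<in>| {|n|} \<and> t |\<in>| S \<and> t < s} = Pair n ` (set ?xs \<inter> {s. s < n})" by auto
  then have "inversions {|n|} S = card (set ?xs \<inter> {s. s < n})"
    by (simp only: inversions_def) (simp add: card_image inj_on_def)
  also have "set ?xs \<inter> {s. s < n} = set (filter (\<lambda>s. s < n) ?xs)"
    by auto
  also have "card \<dots> = length (filter (\<lambda>s. s < n) ?xs)"
    by (rule distinct_card) simp
  finally show ?thesis
    using assms foldr_creat_insort[of ?xs n vac] by (simp add: monom_vec_def)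
qed

text \<open>On a monomial containing \<open>n\<close> both sides vanish; otherwise the sign of
  \<open>wedge_basis\<close> meets the equal sign of \<open>monom_vec_finsert\<close> and they
  cancel.\<close>

lemma fock_map_xi: "fock_map (xi n \<odot> u) = creat n (fock_map u)"
proof (rule linear_eq_on_basis[where s = scale and v = u])
  show "Vector_Spaces.linear fscale scale (\<lambda>u. fock_map (xi n \<odot> u))"
    "Vector_Spaces.linear fscale scale (\<lambda>u. creat n (fock_map u))"
    unfolding linear_iff_add_scale[OF free.vector_space_axioms M.vector_space_axioms]
    by (simp_all add: creat_def M.scale_right_distrib mult.commute)
  fix S
  show "fock_map (xi n \<odot> basis S) = creat n (fock_map (basis S))"
  proof (cases "n |\<in>| S")
    case True
    then obtain T where T: "S = finsert n T" "n |\<notin>| T" by (metis mk_disjoint_finsert)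
    then have "creat n (monom_vec S) = 0"
      by (simp add: monom_vec_finsert creat_creat)
    then show ?thesis using True by (simp add: xi_def wedge_basis_def)
  next
    case False
    then show ?thesis
      by (simp add: xi_def wedge_basis_def monom_vec_finsert flip: power_add mult_2)
  qed
qed

lemma linear_annih: "Vector_Spaces.linear fscale scale (\<lambda>u. annih n (fock_map u))"
  unfolding linear_iff_add_scale[OF free.vector_space_axioms M.vector_space_axioms]
  by (simp add: annih_def M.scale_right_distrib mult.commute)

text \<open>Induction on the monomial: the vacuum is annihilated, and each further generator is
  handled by the matching relations \<open>pd_xi_wedge\<close> and
  \<open>annih_creat\<close>.\<close>

lemma fock_map_pd: "fock_map (pd n u) = annih n (fock_map u)"
proof (rule linear_eq_on_basis[where s = scale and v = u, OF _ linear_annih])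
  show lin: "Vector_Spaces.linear fscale scale (\<lambda>u. fock_map (pd n u))"
    unfolding linear_iff_add_scale[OF free.vector_space_axioms M.vector_space_axioms] by simp
  note scale = linear_iff_add_scale[OF free.vector_space_axioms M.vector_space_axioms, THEN iffD1,
      THEN conjunct2, rule_format]
  fix S
  show "fock_map (pd n (basis S)) = annih n (fock_map (basis S))"
  proof (induction S)
    case empty
    have "pd n (basis {||}) = 0" by (rule pd_basis_notin) simp
    then show ?case
      by (simp add: annih_def monom_vec_def vac del: pd_basis_basis)
  next
    case (insert k S)
    obtain c where c: "basis (finsert k S) = fscale c (xi k \<odot> basis S)"
      using basis_finsert insert.hyps by blast
    have "fock_map (pd n (xi k \<odot> basis S)) = annih n (fock_map (xi k \<odot> basis S))"
      using insert.IH
      by (simp add: pd_xi_wedge fock_map_xi annih_creat del: pd_basis_basis wedge_basis_basis)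
    then show ?case
      unfolding c using scale[OF lin] scale[OF linear_annih] by simp
  qed
qed

text \<open>By linearity in \<open>x\<close>, basis vectors suffice. The factor \<open>\<mu>\<close>
  from \<open>sigma\<close> cancels the \<open>inverse \<mu>\<close> in \<open>annih\<close> and
  \<open>creat\<close>; on \<open>zc\<close> both sides scale by \<open>\<mu>^2\<close>.\<close>

lemma fock_map_equivariant: "fock_map (twist \<mu> fock_act x u) = act x (fock_map u)"
proof (rule linear_eq_on_basis[where s = scale and v = x])
  show "Vector_Spaces.linear fscale scale (\<lambda>x. fock_map (twist \<mu> fock_act x u))"
    unfolding linear_iff_add_scale[OF free.vector_space_axioms M.vector_space_axioms]
    by (simp add: twist_def sigma_def)
  show "Vector_Spaces.linear fscale scale (\<lambda>x. act x (fock_map u))"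
    by (rule act_linear_left)
  show "fock_map (twist \<mu> fock_act (basis b) u) = act (basis b) (fock_map u)" for b
    using mu
    by (cases b)
      (simp_all add: twist_def sigma_def fock_map_pd fock_map_xi annih_def creat_def central)
qed

text \<open>Each creation operator is odd, and the vacuum has parity \<open>p\<close>.\<close>

lemma foldr_creat_graded: "foldr creat xs vac \<in> gr (of_nat (length xs) + p)"
proof (induction xs)
  case Nil
  show ?case using vac(1) by (simp only: list.size of_nat_0 add_0 foldr.simps id_apply)
next
  case (Cons n xs)
  from act_graded[OF psi_odd Cons.IH, of "- int n - 1"]
  have "creat n (foldr creat xs vac) \<in> gr (1 + (of_nat (length xs) + p))"
    unfolding creat_def by (rule M.subspace_scale[OF M.gr_subspace])
  then show ?case
    by (simp only: foldr.simps o_apply list.size of_nat_Suc add.assoc One_nat_def add_Suc_right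
        add_0_right)
qed

lemma fock_map_graded:
  assumes "u \<in> ext_gr i"
  shows "fock_map u \<in> gr (i + p)"
  unfolding fock_map_def
proof (intro M.subspace_sum M.subspace_scale M.gr_subspace)
  fix S assume "S \<in> Poly_Mapping.keys u"
  then have "i = of_nat (fcard S)" using assms by (simp add: ext_gr_def)
  then show "monom_vec S \<in> gr (i + p)"
    using foldr_creat_graded[of "sorted_list_of_set (fset S)"]
    by (simp add: monom_vec_def fcard.rep_eq)
qed

text \<open>By \<open>fock_map_pd\<close> the kernel is closed under every \<open>pd n\<close>, and
  \<open>ext_one\<close> goes to the nonzero vacuum.\<close>

lemma inj_fock_map: "inj fock_map"
proof (rule injI)
  fix u v assume "fock_map u = fock_map v"
  then have "fock_map (u - v) = 0" by simp
  then have "u - v = 0"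
    by (rule flinear_kernel_vacuum[OF linear_fock_map, rotated 2])
      (simp_all add: fock_map_pd annih_def fock_map_one vac)
  then show "u = v" by simp
qed

lemma isomorphic_twisted_fock:
  assumes "simple_supermodule scale gr act"
  shows "supermodule_isomorphic scale gr act fscale ext_gr (twist \<mu> fock_act)"
proof -
  have ext: "super_vector_space fscale ext_gr"
    unfolding ext_gr_coord by (rule super_vector_space_coord_gr)
  have "fock_map ext_one \<noteq> 0" by (simp add: fock_map_one vac)
  then have "surj fock_map"
    using surj_if_simple[OF ext M.super_vector_space_axioms assms linear_fock_map,
        where ?act1.0 = "twist \<mu> fock_act" and ?u0.0 = ext_one and p = p]
      fock_map_graded fock_map_equivariant by blast
  then have "bij fock_map" using inj_fock_map by (simp add: bij_def)
  \<comment> \<open>The required isomorphism leaves the given module, so it is the inverse of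
    \<open>fock_map\<close>.\<close>
  then show ?thesis
    using supermodule_isomorphicI[OF ext M.super_vector_space_axioms linear_fock_map,
        where ?act1.0 = "twist \<mu> fock_act" and ?act2.0 = act and p = p]
      fock_map_graded fock_map_equivariant by blast
qed

end

theorem lemma3p7:
  fixes scale :: "complex \<Rightarrow> 'v::ab_group_add \<Rightarrow> 'v"
    and gr :: "bit \<Rightarrow> 'v set"
    and act :: "fermion \<Rightarrow> 'v \<Rightarrow> 'v"
    and lam :: complex
  assumes "fermion_module scale gr act"
    and "simple_supermodule scale gr act"
    and "smooth act"
    and "lam \<noteq> 0"
    and "\<And>v. act zc v = scale lam v"
  shows "\<exists>\<mu>::complex. \<mu>^2 = lam \<and>
           supermodule_isomorphic scale gr act fscale ext_gr (twist \<mu> fock_act)"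
proof -
  \<comment> \<open>Either square root would serve: only its square and its being nonzero enter
    below.\<close>
  define \<mu> where "\<mu> = csqrt lam"
  have sqrt: "\<mu>^2 = lam" "\<mu> \<noteq> 0" using assms(4) by (auto simp: \<mu>_def)
  interpret clifford_module scale gr act \<mu>
    using assms(1,5) sqrt by (simp add: clifford_module_def clifford_module_axioms_def)
  \<comment> \<open>Simplicity includes that the module is nonzero, as \<open>ex_vacuum\<close>
    requires.\<close>
  obtain v p where "v \<in> gr p" "v \<noteq> 0" "\<And>n. act (psi (int n)) v = 0"
    using ex_vacuum[OF assms(3)] assms(2) by (auto simp: simple_supermodule_def)
  then interpret vacuum_module scale gr act \<mu> v p
    by unfold_locales
  from isomorphic_twisted_fock[OF assms(2)] sqrt(1) show ?thesis by blast
qed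

end
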